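(* Let $\tau_0,\tau_1$ be consecutive patterns, let $\tau=\tau_0\text{-}\tau_1$ and $\phi=f_1(\tau_0)\text{-}f_2(\tau_1)$ be multi-patterns, where $f_1$ and $f_2$ are any of the trivial bijections $R,I$. Then $\tau\equiv\phi$.
   Context: A composition $\sigma=\sigma_1\ldots\sigma_m$ of $n$ with $m$ parts in a finite set $A$ of positive integers is a sequence of $m$ elements of $A$ with sum $n$; the set of these is $C_{n;m}^A$. A partially ordered pattern (POP) is a word $\rho_1\ldots\rho_r$ of letters from a partially ordered alphabet (repeated letters allowed), possibly with dashes between some neighbouring letters. An occurrence of $\rho$ in $\sigma$ is a choice of positions $i_1<\cdots<i_r$ such that: $i_{p+1}=i_p+1$ whenever there is no dash between $\rho_p$ and $\rho_{p+1}$; $\sigma_{i_p}=\sigma_{i_q}$ whenever $\rho_p=\rho_q$; and $\sigma_{i_p}<\sigma_{i_q}$ whenever $\rho_p<\rho_q$. Nothing is required for incomparable letters. $\sigma$ avoids $\rho$ if it has no occurrence of $\rho$. Two POPs are equivalent, $\tau\equiv\phi$, if for every finite set $A$ of positive integers and all $n,m$ the number of compositions in $C_{n;m}^A$ that avoid $\tau$ equals the number that avoid $\phi$. A consecutive pattern is a dash-free word over a totally ordered alphabet $[t]=\{1,\dots,t\}$ that contains each letter of $[t]$ at least once. For consecutive patterns $\alpha,\beta$, the multi-pattern $\alpha\text{-}\beta$ is the POP consisting of $\alpha$, a dash, and $\beta$, where every letter of the block $\alpha$ is incomparable with every letter of the block $\beta$ (disjoint copies of the alphabets are used, and the order inside each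 block is kept). $R$ is the reversal, $R(w_1w_2\ldots w_r)=w_r\ldots w_2w_1$, and $I$ is the identity; these are the trivial bijections. *)

theory Defs
  imports Main
begin

text \<open>The disjoint (parallel) sum order: elements of different summands are incomparable.\<close>

instantiation sum :: (order, order) order
begin

fun less_eq_sum :: "'a + 'b \<Rightarrow> 'a + 'b \<Rightarrow> bool" where
  "Inl a \<le> Inl b \<longleftrightarrow> a \<le> b"
| "Inr a \<le> Inr b \<longleftrightarrow> a \<le> b"
| "Inl a \<le> Inr b \<longleftrightarrow> False"
| "Inr a \<le> Inl b \<longleftrightarrow> False"

definition less_sum :: "'a + 'b \<Rightarrow> 'a + 'b \<Rightarrow> bool" where
  "x < y \<longleftrightarrow> x \<le> y \<and> \<not> y \<le> (x :: 'a + 'b)"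

instance
proof
  fix x y z :: "'a + 'b"
  show "x < y \<longleftrightarrow> x \<le> y \<and> \<not> y \<le> x" by (rule less_sum_def)
  show "x \<le> x" by (cases x) auto
  show "x \<le> y \<Longrightarrow> y \<le> z \<Longrightarrow> x \<le> z" by (cases x; cases y; cases z) auto
  show "x \<le> y \<Longrightarrow> y \<le> x \<Longrightarrow> x = y" by (cases x; cases y) auto
qed

end

lemma less_sum_simps [simp]:
  "Inl a < (Inl b :: 'a::order + 'b::order) \<longleftrightarrow> a < b"
  "Inr c < (Inr d :: 'a::order + 'b::order) \<longleftrightarrow> c < d"
  "\<not> Inl a < (Inr d :: 'a::order + 'b::order)"
  "\<not> Inr c < (Inl b :: 'a::order + 'b::order)"
  by (auto simp: less_sum_def less_le_not_le)

definition compositions :: "nat set \<Rightarrow> nat \<Rightarrow> nat \<Rightarrow> nat list set" where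
  "compositions A n m = {\<sigma>. set \<sigma> \<subseteq> A \<and> length \<sigma> = m \<and> sum_list \<sigma> = n}"

text \<open>A number \<open>d\<close> in \<open>dashes\<close> stands for a dash directly after the first \<open>d\<close> letters,
  that is, between the letters with 0-based indices \<open>d - 1\<close> and \<open>d\<close>.\<close>

datatype 'a pop = POP (letters: "'a list") (dashes: "nat set")

text \<open>The list \<open>is\<close> holds the positions, counted from 0, of the chosen parts of \<open>\<sigma>\<close>.\<close>

definition occurrence :: "'a::order pop \<Rightarrow> nat list \<Rightarrow> nat list \<Rightarrow> bool" where
  "occurrence \<rho> \<sigma> is \<longleftrightarrow>
     length is = length (letters \<rho>) \<and>
     sorted_wrt (<) is \<and>
     (\<forall>i \<in> set is. i < length \<sigma>) \<and>
     (\<forall>p. Suc p < length is \<and> Suc p \<notin> dashes \<rho> \<longrightarrow> is ! Suc p = Suc (is ! p)) \<and>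
     (\<forall>p < length is. \<forall>q < length is.
        (letters \<rho> ! p = letters \<rho> ! q \<longrightarrow> \<sigma> ! (is ! p) = \<sigma> ! (is ! q)) \<and>
        (letters \<rho> ! p < letters \<rho> ! q \<longrightarrow> \<sigma> ! (is ! p) < \<sigma> ! (is ! q)))"

definition avoids :: "nat list \<Rightarrow> 'a::order pop \<Rightarrow> bool" where
  "avoids \<sigma> \<rho> \<longleftrightarrow> (\<nexists>is. occurrence \<rho> \<sigma> is)"

definition pop_equiv :: "'a::order pop \<Rightarrow> 'b::order pop \<Rightarrow> bool" where
  "pop_equiv \<tau> \<phi> \<longleftrightarrow>
     (\<forall>A n m. finite A \<and> (\<forall>a \<in> A. 0 < a) \<longrightarrow>
        card {\<sigma> \<in> compositions A n m. avoids \<sigma> \<tau>} =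
        card {\<sigma> \<in> compositions A n m. avoids \<sigma> \<phi>})"

definition consecutive_pattern :: "nat list \<Rightarrow> bool" where
  "consecutive_pattern \<alpha> \<longleftrightarrow> (\<exists>t \<ge> 1. set \<alpha> = {1..t})"

definition multi_pattern :: "nat list \<Rightarrow> nat list \<Rightarrow> (nat + nat) pop" where
  "multi_pattern \<alpha> \<beta> = POP (map Inl \<alpha> @ map Inr \<beta>) {length \<alpha>}"

definition trivial_bijections :: "('a list \<Rightarrow> 'a list) set" where
  "trivial_bijections = {rev, id}"

end

theory Submission
  imports Defs "HOL-Library.Sublist" "HOL-Library.Multiset"
begin

text \<open>
  Incomparable blocks impose no condition on each other, so a composition contains
  \<open>\<alpha>-\<beta>\<close> exactly when it splits as \<open>u @ v\<close> with \<open>\<alpha>\<close> occurring in \<open>u\<close> and \<open>\<beta>\<close> occurring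
  in \<open>v\<close> (\<open>avoids_multi_pattern_iff\<close>).  It suffices to test the shortest prefix \<open>u\<close> that
  contains \<open>\<alpha>\<close>, since it leaves the longest remainder \<open>v\<close>; if no prefix
  contains \<open>\<alpha>\<close>, the composition avoids every pattern \<open>\<alpha>-\<beta>\<close>.

  Reversing this remainder does not change the shortest prefix, so it is an involution on
  compositions; it keeps the parts, and it exchanges an occurrence of \<open>\<beta>\<close> in \<open>v\<close> for one of
  \<open>rev \<beta>\<close> in \<open>rev v\<close>.  Hence \<open>\<alpha>-\<beta>\<close> and \<open>\<alpha>-rev \<beta>\<close> are equivalent
  (\<open>pop_equiv_rev_right\<close>).  Reversing whole compositions shows that \<open>\<alpha>-\<beta>\<close> is equivalent to
  \<open>rev \<beta>-rev \<alpha>\<close>, and combining the two moves yields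
  \<open>\<alpha>-\<beta> \<equiv> rev \<beta>-rev \<alpha> \<equiv> rev \<beta>-\<alpha> \<equiv> rev \<alpha>-\<beta>\<close>, which reverses the first block.
\<close>

section \<open>Occurrences of multi-patterns\<close>

definition matches :: "'a::order list \<Rightarrow> nat list \<Rightarrow> bool" where
  "matches \<alpha> w \<longleftrightarrow> length w = length \<alpha> \<and>
     (\<forall>p < length \<alpha>. \<forall>q < length \<alpha>.
        (\<alpha> ! p = \<alpha> ! q \<longrightarrow> w ! p = w ! q) \<and> (\<alpha> ! p < \<alpha> ! q \<longrightarrow> w ! p < w ! q))"

definition contains :: "'a::order list \<Rightarrow> nat list \<Rightarrow> bool" where
  "contains \<alpha> \<sigma> \<longleftrightarrow> (\<exists>w. sublist w \<sigma> \<and> matches \<alpha> w)"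

lemma matches_rev: "matches \<alpha> w \<Longrightarrow> matches (rev \<alpha>) (rev w)"
  by (auto simp: matches_def rev_nth)

lemma contains_rev: "contains \<alpha> \<sigma> \<Longrightarrow> contains (rev \<alpha>) (rev \<sigma>)"
  by (metis contains_def matches_rev sublist_rev)

lemma contains_rev_iff: "contains (rev \<alpha>) \<sigma> \<longleftrightarrow> contains \<alpha> (rev \<sigma>)"
  by (metis contains_rev rev_rev_ident)

lemma contains_append_left: "contains \<alpha> v \<Longrightarrow> contains \<alpha> (u @ v)"
  by (meson contains_def sublist_append_leftI sublist_order.order_trans)

text \<open>An \<open>Inl\<close> letter is neither equal nor comparable to an \<open>Inr\<close> letter, so only the conditions inside
  each block remain.\<close>

lemma matches_sum_append:
  assumes "length w = length \<alpha>" "length w' = length \<beta>"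
  shows "matches (map Inl \<alpha> @ map Inr \<beta>) (w @ w') \<longleftrightarrow> matches \<alpha> w \<and> matches \<beta> w'"
    (is "?L \<longleftrightarrow> ?R")
proof
  assume L: ?L
  let ?l = "map Inl \<alpha> @ map Inr \<beta>" and ?w = "w @ w'"
  have order: "(?l ! p = ?l ! q \<longrightarrow> ?w ! p = ?w ! q) \<and> (?l ! p < ?l ! q \<longrightarrow> ?w ! p < ?w ! q)"
    if "p < length \<alpha> + length \<beta>" "q < length \<alpha> + length \<beta>" for p q
    using L that unfolding matches_def length_append length_map by blast
  have "matches \<alpha> w"
    unfolding matches_def
  proof (intro conjI allI impI)
    fix p q assume pq: "p < length \<alpha>" "q < length \<alpha>"
    then show "\<alpha> ! p = \<alpha> ! q \<Longrightarrow> w ! p = w ! q" "\<alpha> ! p < \<alpha> ! q \<Longrightarrow> w ! p < w ! q"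
      using order[of p q] assms by (simp_all add: nth_append)
  qed (use assms in simp)
  moreover have "matches \<beta> w'"
    unfolding matches_def
  proof (intro conjI allI impI)
    fix p q assume pq: "p < length \<beta>" "q < length \<beta>"
    then show "\<beta> ! p = \<beta> ! q \<Longrightarrow> w' ! p = w' ! q" "\<beta> ! p < \<beta> ! q \<Longrightarrow> w' ! p < w' ! q"
      using order[of "length \<alpha> + p" "length \<alpha> + q"] assms by (simp_all add: nth_append)
  qed (use assms in simp)
  ultimately show ?R ..
next
  assume R: ?R
  let ?l = "map Inl \<alpha> @ map Inr \<beta>" and ?w = "w @ w'"
  show ?L
    unfolding matches_def
  proof (intro conjI allI impI)
    fix p q assume p: "p < length ?l" and q: "q < length ?l"
    have left: "(\<alpha> ! i = \<alpha> ! j \<longrightarrow> w ! i = w ! j) \<and> (\<alpha> ! i < \<alpha> ! j \<longrightarrow> w ! i < w ! j)"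
      if "i < length \<alpha>" "j < length \<alpha>" for i j
      using R that unfolding matches_def by blast
    have right: "(\<beta> ! i = \<beta> ! j \<longrightarrow> w' ! i = w' ! j) \<and> (\<beta> ! i < \<beta> ! j \<longrightarrow> w' ! i < w' ! j)"
      if "i < length \<beta>" "j < length \<beta>" for i j
      using R that unfolding matches_def by blast
    show "?l ! p = ?l ! q \<Longrightarrow> ?w ! p = ?w ! q" "?l ! p < ?l ! q \<Longrightarrow> ?w ! p < ?w ! q"
      using p q assms left[of p q] right[of "p - length \<alpha>" "q - length \<alpha>"]
      by (cases "p < length \<alpha>"; cases "q < length \<alpha>"; simp add: nth_append)+
  qed (use assms in simp)
qed

lemma occurrence_multi_pattern_iff:
  "occurrence (multi_pattern \<alpha> \<beta>) \<sigma> is \<longleftrightarrow>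
     length is = length \<alpha> + length \<beta> \<and>
     sorted_wrt (<) is \<and>
     (\<forall>i \<in> set is. i < length \<sigma>) \<and>
     (\<forall>p. Suc p < length is \<and> Suc p \<noteq> length \<alpha> \<longrightarrow> is ! Suc p = Suc (is ! p)) \<and>
     matches (map Inl \<alpha> @ map Inr \<beta>) (map ((!) \<sigma>) is)"
proof (cases "length is = length \<alpha> + length \<beta>")
  case True
  then have "matches l (map ((!) \<sigma>) is) \<longleftrightarrow>
      (\<forall>p < length is. \<forall>q < length is.
        (l ! p = l ! q \<longrightarrow> \<sigma> ! (is ! p) = \<sigma> ! (is ! q)) \<and>
        (l ! p < l ! q \<longrightarrow> \<sigma> ! (is ! p) < \<sigma> ! (is ! q)))"
    if "length l = length \<alpha> + length \<beta>" for l :: "(nat + nat) list"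
    using that by (simp add: matches_def)
  then show ?thesis
    by (simp add: occurrence_def multi_pattern_def)
qed (simp add: occurrence_def multi_pattern_def)

lemma consecutive_steps_eq_upt:
  assumes "\<And>p. Suc p < length is \<Longrightarrow> is ! Suc p = Suc (is ! p)"
  obtains i where "is = [i..<i + length is]"
proof
  show "is = [is ! 0..<is ! 0 + length is]"
  proof (rule nth_equalityI)
    fix p assume "p < length is"
    then have "is ! p = is ! 0 + p"
      using assms by (induction p) auto
    with \<open>p < length is\<close> show "is ! p = [is ! 0..<is ! 0 + length is] ! p" by simp
  qed simp
qed

lemma map_nth_upt_eq_middle: "map ((!) (x @ w @ y)) [length x..<length x + length w] = w"
  by (rule nth_equalityI) (auto simp: nth_append)

lemma map_nth_upt_take_drop:
  "i + k \<le> length \<sigma> \<Longrightarrow> map ((!) \<sigma>) [i..<i + k] = take k (drop i \<sigma>)"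
  by (rule nth_equalityI) auto

text \<open>The dash after \<open>\<alpha>\<close> is the only place where the chosen positions may jump, so they form two
  runs of neighbours, the first ending before the second starts; splitting the word between the
  runs separates the occurrence of \<open>\<alpha>\<close> from that of \<open>\<beta>\<close>.\<close>

lemma occurrence_multi_patternD:
  assumes "occurrence (multi_pattern \<alpha> \<beta>) \<sigma> is"
  shows "\<exists>u v. \<sigma> = u @ v \<and> contains \<alpha> u \<and> contains \<beta> v"
proof -
  define I J where "I = take (length \<alpha>) is" and "J = drop (length \<alpha>) is"
  note occ = assms[unfolded occurrence_multi_pattern_iff]
  have len: "length I = length \<alpha>" "length J = length \<beta>" and isIJ: "is = I @ J"
    using occ by (auto simp: I_def J_def)
  have step: "is ! Suc p = Suc (is ! p)" if "Suc p < length is" "Suc p \<noteq> length \<alpha>" for p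
    using occ that by blast
  obtain i where i: "I = [i..<i + length \<alpha>]"
  proof (rule consecutive_steps_eq_upt[of I])
    fix p assume "Suc p < length I"
    then show "I ! Suc p = Suc (I ! p)"
      using step[of p] len by (simp add: isIJ nth_append)
  qed (use len that in auto)
  obtain j where j: "J = [j..<j + length \<beta>]"
  proof (rule consecutive_steps_eq_upt[of J])
    fix p assume "Suc p < length J"
    then show "J ! Suc p = Suc (J ! p)"
      using step[of "length \<alpha> + p"] len by (simp add: isIJ nth_append)
  qed (use len that in auto)
  have m: "matches \<alpha> (map ((!) \<sigma>) I)" "matches \<beta> (map ((!) \<sigma>) J)"
    using occ len by (simp_all add: isIJ matches_sum_append)
  have bnd: "\<forall>k \<in> set I \<union> set J. k < length \<sigma>"
    and less: "\<forall>k \<in> set I. \<forall>l \<in> set J. k < l"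
    using occ by (auto simp: isIJ sorted_wrt_append)
  \<comment> \<open>An empty run of positions does not determine where it starts, so the split goes directly
    after the first run, and at the very front if that run is empty.\<close>
  define c where "c = (if \<alpha> = [] then 0 else i + length \<alpha>)"
  have "contains \<alpha> (take c \<sigma>)"
  proof (cases "\<alpha> = []")
    case True
    then show ?thesis by (auto simp: contains_def matches_def)
  next
    case False
    then have "i + length \<alpha> - 1 \<in> set I" by (cases \<alpha>) (auto simp: i)
    with bnd have "i + length \<alpha> - 1 < length \<sigma>" by blast
    then have le: "i + length \<alpha> \<le> length \<sigma>" by simp
    have "take c \<sigma> = take i \<sigma> @ take (length \<alpha>) (drop i \<sigma>)"
      using False by (simp add: c_def take_add)
    moreover have "map ((!) \<sigma>) I = take (length \<alpha>) (drop i \<sigma>)"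
      using map_nth_upt_take_drop[OF le] i by simp
    ultimately show ?thesis
      using m(1) by (metis contains_def sublist_append_leftI sublist_order.order_refl)
  qed
  moreover have "contains \<beta> (drop c \<sigma>)"
  proof (cases "\<beta> = []")
    case True
    then show ?thesis by (auto simp: contains_def matches_def)
  next
    case False
    then have ends: "j + length \<beta> - 1 \<in> set J" "j \<in> set J" by (cases \<beta>; auto simp: j)+
    with bnd have "j + length \<beta> - 1 < length \<sigma>" by blast
    then have le: "j + length \<beta> \<le> length \<sigma>" by simp
    have "c \<le> j"
    proof (cases "\<alpha> = []")
      case False
      then have "i + length \<alpha> - 1 \<in> set I" by (cases \<alpha>) (auto simp: i)
      with less ends have "i + length \<alpha> - 1 < j" by blast
      then have "i + length \<alpha> \<le> j" by arith
      then show ?thesis by (simp add: c_def)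
    qed (simp add: c_def)
    then have "drop c \<sigma> = take (j - c) (drop c \<sigma>) @ drop j \<sigma>"
      by (metis append_take_drop_id drop_drop le_add_diff_inverse2)
    moreover have "drop j \<sigma> = map ((!) \<sigma>) J @ drop (length \<beta>) (drop j \<sigma>)"
      using map_nth_upt_take_drop[OF le] j by (metis append_take_drop_id)
    ultimately have "sublist (map ((!) \<sigma>) J) (drop c \<sigma>)"
      by (metis sublist_appendI)
    with m(2) show ?thesis by (auto simp: contains_def)
  qed
  ultimately show ?thesis by (metis append_take_drop_id)
qed

lemma occurrence_multi_patternI:
  assumes "contains \<alpha> u" "contains \<beta> v"
  shows "\<exists>is. occurrence (multi_pattern \<alpha> \<beta>) (u @ v) is"
proof -
  from assms obtain x w y x' w' y'
    where u: "u = x @ w @ y" and w: "matches \<alpha> w"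
      and v: "v = x' @ w' @ y'" and w': "matches \<beta> w'"
    by (auto simp: contains_def sublist_def)
  have len: "length w = length \<alpha>" "length w' = length \<beta>"
    using w w' by (auto simp: matches_def)
  define j where "j = length (x @ w @ y @ x')"
  define I J where "I = [length x..<length x + length w]" and "J = [j..<j + length w']"
  have "map ((!) (u @ v)) I = w"
    using map_nth_upt_eq_middle[of x w "y @ v"] by (simp add: u I_def)
  moreover have "map ((!) (u @ v)) J = w'"
    using map_nth_upt_eq_middle[of "x @ w @ y @ x'" w' y'] by (simp add: u v J_def j_def)
  ultimately have "matches (map Inl \<alpha> @ map Inr \<beta>) (map ((!) (u @ v)) (I @ J))"
    using w w' len by (simp add: matches_sum_append)
  moreover have "sorted_wrt (<) (I @ J)" "\<forall>i \<in> set (I @ J). i < length (u @ v)"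
    by (auto simp: sorted_wrt_append I_def J_def u v j_def)
  moreover have "(I @ J) ! Suc p = Suc ((I @ J) ! p)"
    if "Suc p < length (I @ J)" "Suc p \<noteq> length \<alpha>" for p
    using that len by (auto simp: nth_append I_def J_def)
  ultimately have "occurrence (multi_pattern \<alpha> \<beta>) (u @ v) (I @ J)"
    unfolding occurrence_multi_pattern_iff using len by (auto simp: I_def J_def)
  then show ?thesis ..
qed

lemma avoids_multi_pattern_iff:
  "avoids \<sigma> (multi_pattern \<alpha> \<beta>) \<longleftrightarrow> (\<nexists>u v. \<sigma> = u @ v \<and> contains \<alpha> u \<and> contains \<beta> v)"
  unfolding avoids_def using occurrence_multi_patternD occurrence_multi_patternI by blast


section \<open>Reversing the remainder after the shortest good prefix\<close>

definition cut_point :: "('a list \<Rightarrow> bool) \<Rightarrow> 'a list \<Rightarrow> nat" where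
  "cut_point P \<sigma> = (LEAST k. P (take k \<sigma>))"

text \<open>Lists without a good prefix have to be fixed, so that the map is an involution on all
  lists.\<close>

definition flip_rest :: "('a list \<Rightarrow> bool) \<Rightarrow> 'a list \<Rightarrow> 'a list" where
  "flip_rest P \<sigma> =
     (if \<exists>k. P (take k \<sigma>) then take (cut_point P \<sigma>) \<sigma> @ rev (drop (cut_point P \<sigma>) \<sigma>) else \<sigma>)"

lemma cut_le_length:
  assumes "P (take k \<sigma>)"
  shows "cut_point P \<sigma> \<le> length \<sigma>"
proof (cases "k \<le> length \<sigma>")
  case True
  then show ?thesis using Least_le[of "\<lambda>k. P (take k \<sigma>)", OF assms] by (simp add: cut_point_def)
next
  case False
  with assms have "P (take (length \<sigma>) \<sigma>)" by simp
  then show ?thesis unfolding cut_point_def by (rule Least_le)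
qed

text \<open>Prefixes no longer than the cut point are untouched, so the shortest good prefix
  stays the shortest.\<close>

lemma flip_rest_props:
  assumes "P (take k \<sigma>)"
  shows take_cut_flip_rest: "take (cut_point P \<sigma>) (flip_rest P \<sigma>) = take (cut_point P \<sigma>) \<sigma>"
    and drop_cut_flip_rest: "drop (cut_point P \<sigma>) (flip_rest P \<sigma>) = rev (drop (cut_point P \<sigma>) \<sigma>)"
    and cut_flip_rest: "cut_point P (flip_rest P \<sigma>) = cut_point P \<sigma>"
    and good_prefix_flip_rest: "P (take (cut_point P \<sigma>) (flip_rest P \<sigma>))"
proof -
  note le = cut_le_length[of P, OF assms]
  have eq: "flip_rest P \<sigma> = take (cut_point P \<sigma>) \<sigma> @ rev (drop (cut_point P \<sigma>) \<sigma>)"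
    using assms by (auto simp: flip_rest_def)
  show t: "take (cut_point P \<sigma>) (flip_rest P \<sigma>) = take (cut_point P \<sigma>) \<sigma>"
    and "drop (cut_point P \<sigma>) (flip_rest P \<sigma>) = rev (drop (cut_point P \<sigma>) \<sigma>)"
    using le by (simp_all add: eq)
  have P: "P (take (cut_point P \<sigma>) \<sigma>)"
    unfolding cut_point_def using assms by (rule LeastI)
  with t show "P (take (cut_point P \<sigma>) (flip_rest P \<sigma>))" by simp
  have below: "take j (flip_rest P \<sigma>) = take j \<sigma>" if "j \<le> cut_point P \<sigma>" for j
    using t that by (metis min.absorb1 take_take)
  show "cut_point P (flip_rest P \<sigma>) = cut_point P \<sigma>"
    unfolding cut_point_def[of P "flip_rest P \<sigma>"]
  proof (rule Least_equality)
    show "P (take (cut_point P \<sigma>) (flip_rest P \<sigma>))" using t P by simp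
    fix j assume j: "P (take j (flip_rest P \<sigma>))"
    show "cut_point P \<sigma> \<le> j"
    proof (rule ccontr)
      assume "\<not> cut_point P \<sigma> \<le> j"
      with below j have "P (take j \<sigma>)" "j < cut_point P \<sigma>" by simp_all
      then show False unfolding cut_point_def using not_less_Least by blast
    qed
  qed
qed

lemma flip_rest_involution: "flip_rest P (flip_rest P \<sigma>) = \<sigma>"
proof (cases "\<exists>k. P (take k \<sigma>)")
  case True
  then obtain k where k: "P (take k \<sigma>)" ..
  let ?\<rho> = "flip_rest P \<sigma>"
  have "flip_rest P ?\<rho> = take (cut_point P ?\<rho>) ?\<rho> @ rev (drop (cut_point P ?\<rho>) ?\<rho>)"
    using good_prefix_flip_rest[of P, OF k] by (auto simp: flip_rest_def[of P ?\<rho>])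
  also have "\<dots> = take (cut_point P \<sigma>) \<sigma> @ rev (rev (drop (cut_point P \<sigma>) \<sigma>))"
    by (simp only: flip_rest_props[of P, OF k])
  finally show ?thesis by simp
qed (simp add: flip_rest_def)

lemma mset_flip_rest: "mset (flip_rest P \<sigma>) = mset \<sigma>"
  by (simp add: flip_rest_def) (metis append_take_drop_id mset_append)

text \<open>Every good prefix extends the shortest one, so a property of the remainder that survives
  prepending letters need only be tested after the shortest one.\<close>

lemma split_iff_cut:
  assumes "\<And>x v. Q v \<Longrightarrow> Q (x @ v)"
  shows "(\<exists>u v. \<sigma> = u @ v \<and> P u \<and> Q v) \<longleftrightarrow> (\<exists>k. P (take k \<sigma>)) \<and> Q (drop (cut_point P \<sigma>) \<sigma>)"
proof
  assume "\<exists>u v. \<sigma> = u @ v \<and> P u \<and> Q v"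
  then obtain u v where uv: "\<sigma> = u @ v" "P u" "Q v" by blast
  then have P: "P (take (length u) \<sigma>)" by simp
  then have "cut_point P \<sigma> \<le> length u" unfolding cut_point_def by (rule Least_le)
  then have "drop (cut_point P \<sigma>) \<sigma> = drop (cut_point P \<sigma>) u @ v" by (simp add: uv)
  with P assms uv(3) show "(\<exists>k. P (take k \<sigma>)) \<and> Q (drop (cut_point P \<sigma>) \<sigma>)" by metis
next
  assume "(\<exists>k. P (take k \<sigma>)) \<and> Q (drop (cut_point P \<sigma>) \<sigma>)"
  moreover from this have "P (take (cut_point P \<sigma>) \<sigma>)"
    unfolding cut_point_def by (auto intro: LeastI)
  ultimately show "\<exists>u v. \<sigma> = u @ v \<and> P u \<and> Q v" by (metis append_take_drop_id)
qed

lemma avoids_iff_cut: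
  "avoids \<sigma> (multi_pattern \<alpha> \<beta>) \<longleftrightarrow>
     (\<forall>k. \<not> contains \<alpha> (take k \<sigma>)) \<or> \<not> contains \<beta> (drop (cut_point (contains \<alpha>) \<sigma>) \<sigma>)"
  using split_iff_cut[of "contains \<beta>" \<sigma> "contains \<alpha>"] contains_append_left
  unfolding avoids_multi_pattern_iff by metis

text \<open>The part before the cut point, which decides about \<open>\<alpha>\<close>, stays the same, while the part
  after it, which decides about the second block, is reversed.\<close>

lemma avoids_flip_rest:
  assumes "avoids \<sigma> (multi_pattern \<alpha> \<beta>)"
  shows "avoids (flip_rest (contains \<alpha>) \<sigma>) (multi_pattern \<alpha> (rev \<beta>))"
proof (cases "\<exists>k. contains \<alpha> (take k \<sigma>)")
  case True
  then obtain k where k: "contains \<alpha> (take k \<sigma>)" ..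
  have "\<not> contains \<beta> (drop (cut_point (contains \<alpha>) \<sigma>) \<sigma>)"
    using assms True unfolding avoids_iff_cut by blast
  then show ?thesis
    by (simp add: avoids_iff_cut
        flip_rest_props[of "contains \<alpha>", OF k] contains_rev_iff)
next
  case False
  then show ?thesis
    by (simp add: flip_rest_def avoids_iff_cut)
qed


section \<open>Equivalences of multi-patterns\<close>

lemma compositions_cong_mset:
  "mset \<rho> = mset \<sigma> \<Longrightarrow> \<rho> \<in> compositions A n m \<longleftrightarrow> \<sigma> \<in> compositions A n m"
  by (metis (mono_tags, lifting) compositions_def mem_Collect_eq mset_eq_length
      mset_eq_setD sum_mset_sum_list)

text \<open>Rearranging parts stays within the compositions of given sum, length and parts, so one
  involution serves for all \<open>A\<close>, \<open>n\<close> and \<open>m\<close>.\<close>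

lemma pop_equiv_by_involution:
  assumes "\<And>\<sigma>. g (g \<sigma>) = \<sigma>" "\<And>\<sigma>. mset (g \<sigma>) = mset \<sigma>"
    and "\<And>\<sigma>. avoids \<sigma> \<tau> \<Longrightarrow> avoids (g \<sigma>) \<phi>" "\<And>\<sigma>. avoids \<sigma> \<phi> \<Longrightarrow> avoids (g \<sigma>) \<tau>"
  shows "pop_equiv \<tau> \<phi>"
  unfolding pop_equiv_def
proof (intro allI impI)
  fix A n m
  have "bij_betw g {\<sigma> \<in> compositions A n m. avoids \<sigma> \<tau>} {\<sigma> \<in> compositions A n m. avoids \<sigma> \<phi>}"
    by (rule bij_betw_byWitness[where f' = g])
      (use assms compositions_cong_mset[OF assms(2)] in auto)
  then show "card {\<sigma> \<in> compositions A n m. avoids \<sigma> \<tau>} =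
      card {\<sigma> \<in> compositions A n m. avoids \<sigma> \<phi>}"
    by (rule bij_betw_same_card)
qed

lemma pop_equiv_refl: "pop_equiv \<rho> \<rho>"
  by (simp add: pop_equiv_def)

lemma pop_equiv_trans [trans]: "pop_equiv \<rho> \<tau> \<Longrightarrow> pop_equiv \<tau> \<phi> \<Longrightarrow> pop_equiv \<rho> \<phi>"
  by (simp add: pop_equiv_def)

lemma pop_equiv_rev_right: "pop_equiv (multi_pattern \<alpha> \<beta>) (multi_pattern \<alpha> (rev \<beta>))"
  by (rule pop_equiv_by_involution[of "flip_rest (contains \<alpha>)"])
    (use avoids_flip_rest[of _ \<alpha> \<beta>] avoids_flip_rest[of _ \<alpha> "rev \<beta>"]
      in \<open>simp_all add: flip_rest_involution mset_flip_rest\<close>)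

lemma avoids_rev:
  "avoids \<sigma> (multi_pattern \<alpha> \<beta>) \<Longrightarrow> avoids (rev \<sigma>) (multi_pattern (rev \<beta>) (rev \<alpha>))"
  unfolding avoids_multi_pattern_iff contains_rev_iff
  by (metis rev_append rev_rev_ident)

lemma pop_equiv_rev_swap: "pop_equiv (multi_pattern \<alpha> \<beta>) (multi_pattern (rev \<beta>) (rev \<alpha>))"
  by (rule pop_equiv_by_involution[of rev])
    (use avoids_rev[of _ \<alpha> \<beta>] avoids_rev[of _ "rev \<beta>" "rev \<alpha>"] in simp_all)

lemma pop_equiv_rev_left: "pop_equiv (multi_pattern \<alpha> \<beta>) (multi_pattern (rev \<alpha>) \<beta>)"
proof -
  have "pop_equiv (multi_pattern \<alpha> \<beta>) (multi_pattern (rev \<beta>) (rev \<alpha>))"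
    by (rule pop_equiv_rev_swap)
  also have "pop_equiv \<dots> (multi_pattern (rev \<beta>) \<alpha>)"
    using pop_equiv_rev_right[of "rev \<beta>" "rev \<alpha>"] by simp
  also have "pop_equiv \<dots> (multi_pattern (rev \<alpha>) \<beta>)"
    using pop_equiv_rev_swap[of "rev \<beta>" \<alpha>] by simp
  finally show ?thesis .
qed

theorem theorem3p9:
  fixes \<tau>\<^sub>0 \<tau>\<^sub>1 :: "nat list"
    and f\<^sub>1 f\<^sub>2 :: "nat list \<Rightarrow> nat list"
  assumes "consecutive_pattern \<tau>\<^sub>0"
    and "consecutive_pattern \<tau>\<^sub>1"
    and "f\<^sub>1 \<in> trivial_bijections"
    and "f\<^sub>2 \<in> trivial_bijections"
  shows "pop_equiv (multi_pattern \<tau>\<^sub>0 \<tau>\<^sub>1) (multi_pattern (f\<^sub>1 \<tau>\<^sub>0) (f\<^sub>2 \<tau>\<^sub>1))"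
proof -
  have "pop_equiv (multi_pattern \<tau>\<^sub>0 \<tau>\<^sub>1) (multi_pattern (f\<^sub>1 \<tau>\<^sub>0) \<tau>\<^sub>1)"
    using assms(3) by (auto simp: trivial_bijections_def pop_equiv_refl pop_equiv_rev_left)
  moreover have "pop_equiv (multi_pattern (f\<^sub>1 \<tau>\<^sub>0) \<tau>\<^sub>1) (multi_pattern (f\<^sub>1 \<tau>\<^sub>0) (f\<^sub>2 \<tau>\<^sub>1))"
    using assms(4) by (auto simp: trivial_bijections_def pop_equiv_refl pop_equiv_rev_right)
  ultimately show ?thesis by (rule pop_equiv_trans)
qed

end
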